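(* Let $\mathcal{N}$ be a sound, weakly deterministic negotiation arena with atom set $N=N_1\cup N_2$, initial atom $n_0$ and final atom $n_f$. Then Player 1 has a winning strategy in the termination game on $\mathcal{N}$ if and only if $n_0\in\mathcal{A}$, where $\mathcal{A}$ is the attractor of $n_f$.
   Context: A negotiation over a finite set of agents consists of a finite set $N$ of atoms, each atom $n$ having a nonempty set of parties $P_n$ and a finite nonempty set of outcomes $R_n$, an initial atom $n_0$ and a final atom $n_f$ in which every agent participates, and a transition function $\mathcal{X}$ assigning to each triple $(n,a,r)$ with $a\in P_n$, $r\in R_n$ a set of atoms $\mathcal{X}(n,a,r)\subseteq N$, which is empty iff $n=n_f$. A marking maps agents to sets of atoms; the initial marking has $x_0(a)=\{n_0\}$ and the final marking $x_f(a)=\emptyset$ for all $a$. A marking $x$ enables $n$ if $n\in x(a)$ for all $a\in P_n$; then $(n,r)$ for $r\in R_n$ may occur, yielding $x'$ with $x'(a)=\mathcal{X}(n,a,r)$ for $a\in P_n$ and $x'(a)=x(a)$ otherwise. The negotiation is sound if (a) every atom is enabled at some marking reachable from $x_0$, and (b) every occurrence sequence from $x_0$ either leads to $x_f$ or can be extended to one that leads to $x_f$. An agent $a$ is deterministic if for every atom $n\neq n_f$ with $a\in P_n$ and every $r\in R_n$, $\mathcal{X}(n,a,r)$ is a singleton. The negotiation is weakly deterministic if for every $(n,a,r)$ there is a deterministic agent $b$ that is a party of every atom in $\mathcal{X}(n,a,r)$. A set $S$ of atoms is independent if $P_n\cap P_{n'}=\emptyset$ for distinct $n,n'\in S$. A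 negotiation arena is a negotiation with $N$ partitioned into $N_1$ and $N_2$. The game has three players: Player 1, Player 2 and Scheduler. Starting at $x_0$, at each step Scheduler chooses a nonempty independent set $S$ of atoms enabled at the current marking; then Player 1 and Player 2, independently, choose an outcome for each atom in $S\cap N_1$, resp. $S\cap N_2$; these outcomes occur and the game moves to the resulting marking. The play ends when a marking enabling no atom is reached, otherwise it is infinite. A strategy for Player $j$ maps each finite play history together with the set $S$ chosen next by Scheduler to a choice of outcomes for the atoms of $S\cap N_j$; it is winning if Player $j$ wins every play consistent with it. In the termination game Player 1 wins a play iff the play ends with $n_f$ occurring; otherwise Player 2 wins. For an atom $n$ let $P_{n,det}$ be the set of deterministic agents in $P_n$; for $n\neq n_f$ and deterministic $a\in P_n$ write $\mathcal{X}(n,a,r)$ also for the unique atom it contains. The attractor of $n_f$ is $\mathcal{A}=\bigcup_{k\ge0}\mathcal{A}_k$ where $\mathcal{A}_0=\{n_f\}$ and $\mathcal{A}_{k+1}=\mathcal{A}_k\cup\{n\in N_1:\exists r\in R_n\,\forall a\in P_{n,det}:\mathcal{X}(n,a,r)\in\mathcal{A}_k\}\cup\{n\in N_2:\forall r\in R_n\,\forall a\in P_{n,det}:\mathcal{X}(n,a,r)\in\mathcal{A}_k\}$. *)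

theory Defs
  imports Main
begin

record ('a, 'n, 'r) negotiation =
  agents :: "'a set"
  atoms :: "'n set"
  parties :: "'n \<Rightarrow> 'a set"
  outcomes :: "'n \<Rightarrow> 'r set"
  init_atom :: 'n
  final_atom :: 'n
  trans_fun :: "'n \<Rightarrow> 'a \<Rightarrow> 'r \<Rightarrow> 'n set"

locale negotiation =
  fixes \<N> :: "('a, 'n, 'r, 'z) negotiation_scheme"
  assumes finite_agents: "finite (agents \<N>)"
    and finite_atoms: "finite (atoms \<N>)"
    and parties_subset: "n \<in> atoms \<N> \<Longrightarrow> parties \<N> n \<subseteq> agents \<N>"
    and parties_nonempty: "n \<in> atoms \<N> \<Longrightarrow> parties \<N> n \<noteq> {}"
    and finite_outcomes: "n \<in> atoms \<N> \<Longrightarrow> finite (outcomes \<N> n)"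
    and outcomes_nonempty: "n \<in> atoms \<N> \<Longrightarrow> outcomes \<N> n \<noteq> {}"
    and init_in_atoms: "init_atom \<N> \<in> atoms \<N>"
    and final_in_atoms: "final_atom \<N> \<in> atoms \<N>"
    and parties_init: "parties \<N> (init_atom \<N>) = agents \<N>"
    and parties_final: "parties \<N> (final_atom \<N>) = agents \<N>"
    and trans_subset:
      "\<lbrakk>n \<in> atoms \<N>; a \<in> parties \<N> n; r \<in> outcomes \<N> n\<rbrakk> \<Longrightarrow> trans_fun \<N> n a r \<subseteq> atoms \<N>"
    and trans_empty_iff:
      "\<lbrakk>n \<in> atoms \<N>; a \<in> parties \<N> n; r \<in> outcomes \<N> n\<rbrakk>
        \<Longrightarrow> trans_fun \<N> n a r = {} \<longleftrightarrow> n = final_atom \<N>"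

text \<open>A marking is a total function on the type of agents. The initial marking sends everything
  outside the set of agents to the empty set and no occurrence changes this, so that equality of
  reachable markings is equality on the set of agents.\<close>

type_synonym ('a, 'n) marking = "'a \<Rightarrow> 'n set"

definition init_marking :: "('a, 'n, 'r, 'z) negotiation_scheme \<Rightarrow> ('a, 'n) marking" where
  "init_marking \<N> = (\<lambda>a. if a \<in> agents \<N> then {init_atom \<N>} else {})"

definition final_marking :: "('a, 'n) marking" where
  "final_marking = (\<lambda>a. {})"

definition enables :: "('a, 'n, 'r, 'z) negotiation_scheme \<Rightarrow> ('a, 'n) marking \<Rightarrow> 'n \<Rightarrow> bool" where
  "enables \<N> x n \<longleftrightarrow> n \<in> atoms \<N> \<and> (\<forall>a\<in>parties \<N> n. n \<in> x a)"

definition occur ::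
  "('a, 'n, 'r, 'z) negotiation_scheme \<Rightarrow> 'n \<Rightarrow> 'r \<Rightarrow> ('a, 'n) marking \<Rightarrow> ('a, 'n) marking" where
  "occur \<N> n r x = (\<lambda>a. if a \<in> parties \<N> n then trans_fun \<N> n a r else x a)"

inductive occurrence_seq ::
  "('a, 'n, 'r, 'z) negotiation_scheme \<Rightarrow> ('a, 'n) marking \<Rightarrow> ('n \<times> 'r) list \<Rightarrow> ('a, 'n) marking \<Rightarrow> bool"
  for \<N> where
  Nil: "occurrence_seq \<N> x [] x"
| Cons: "\<lbrakk>enables \<N> x n; r \<in> outcomes \<N> n; occurrence_seq \<N> (occur \<N> n r x) w y\<rbrakk>
    \<Longrightarrow> occurrence_seq \<N> x ((n, r) # w) y"

definition reachable :: "('a, 'n, 'r, 'z) negotiation_scheme \<Rightarrow> ('a, 'n) marking \<Rightarrow> bool" where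
  "reachable \<N> x \<longleftrightarrow> (\<exists>w. occurrence_seq \<N> (init_marking \<N>) w x)"

definition sound :: "('a, 'n, 'r, 'z) negotiation_scheme \<Rightarrow> bool" where
  "sound \<N> \<longleftrightarrow>
    (\<forall>n\<in>atoms \<N>. \<exists>x. reachable \<N> x \<and> enables \<N> x n) \<and>
    (\<forall>w x. occurrence_seq \<N> (init_marking \<N>) w x \<longrightarrow>
      x = final_marking \<or> (\<exists>v. occurrence_seq \<N> (init_marking \<N>) (w @ v) final_marking))"

definition deterministic_agent :: "('a, 'n, 'r, 'z) negotiation_scheme \<Rightarrow> 'a \<Rightarrow> bool" where
  "deterministic_agent \<N> a \<longleftrightarrow> a \<in> agents \<N> \<and>
    (\<forall>n\<in>atoms \<N>. n \<noteq> final_atom \<N> \<longrightarrow> a \<in> parties \<N> n \<longrightarrow>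
      (\<forall>r\<in>outcomes \<N> n. is_singleton (trans_fun \<N> n a r)))"

definition det_parties :: "('a, 'n, 'r, 'z) negotiation_scheme \<Rightarrow> 'n \<Rightarrow> 'a set" where
  "det_parties \<N> n = {a \<in> parties \<N> n. deterministic_agent \<N> a}"

definition weakly_deterministic :: "('a, 'n, 'r, 'z) negotiation_scheme \<Rightarrow> bool" where
  "weakly_deterministic \<N> \<longleftrightarrow>
    (\<forall>n\<in>atoms \<N>. \<forall>a\<in>parties \<N> n. \<forall>r\<in>outcomes \<N> n.
      \<exists>b. deterministic_agent \<N> b \<and> (\<forall>n'\<in>trans_fun \<N> n a r. b \<in> parties \<N> n'))"

definition independent :: "('a, 'n, 'r, 'z) negotiation_scheme \<Rightarrow> 'n set \<Rightarrow> bool" where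
  "independent \<N> S \<longleftrightarrow> (\<forall>n\<in>S. \<forall>n'\<in>S. n \<noteq> n' \<longrightarrow> parties \<N> n \<inter> parties \<N> n' = {})"

record ('a, 'n, 'r) arena = "('a, 'n, 'r) negotiation" +
  atoms1 :: "'n set"
  atoms2 :: "'n set"

locale negotiation_arena = negotiation \<N>
  for \<N> :: "('a, 'n, 'r, 'z) arena_scheme" +
  assumes atoms_union: "atoms1 \<N> \<union> atoms2 \<N> = atoms \<N>"
    and atoms_disjoint: "atoms1 \<N> \<inter> atoms2 \<N> = {}"

text \<open>One round of the game is a partial map whose domain is the set \<open>S\<close> chosen by Scheduler and
  whose value at an atom of \<open>S\<close> is the outcome chosen there by the player owning the atom. The
  markings visited by a play are determined by its rounds, so a history is just a list of rounds.\<close>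

type_synonym ('n, 'r) round = "'n \<rightharpoonup> 'r"
type_synonym ('n, 'r) history = "('n, 'r) round list"

definition legal_choice ::
  "('a, 'n, 'r, 'z) negotiation_scheme \<Rightarrow> ('a, 'n) marking \<Rightarrow> 'n set \<Rightarrow> bool" where
  "legal_choice \<N> x S \<longleftrightarrow> S \<noteq> {} \<and> independent \<N> S \<and> (\<forall>n\<in>S. enables \<N> x n)"

definition legal_round ::
  "('a, 'n, 'r, 'z) negotiation_scheme \<Rightarrow> ('a, 'n) marking \<Rightarrow> ('n, 'r) round \<Rightarrow> bool" where
  "legal_round \<N> x m \<longleftrightarrow>
    legal_choice \<N> x (dom m) \<and> (\<forall>n r. m n = Some r \<longrightarrow> r \<in> outcomes \<N> n)"

text \<open>All outcomes of a round occur simultaneously. In a legal round each agent is a party of at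
  most one atom of the domain, so the description below is proper.\<close>

definition occur_round ::
  "('a, 'n, 'r, 'z) negotiation_scheme \<Rightarrow> ('n, 'r) round \<Rightarrow> ('a, 'n) marking \<Rightarrow> ('a, 'n) marking" where
  "occur_round \<N> m x = (\<lambda>a.
    if \<exists>n\<in>dom m. a \<in> parties \<N> n
    then let n = (THE n. n \<in> dom m \<and> a \<in> parties \<N> n) in trans_fun \<N> n a (the (m n))
    else x a)"

definition marking_after ::
  "('a, 'n, 'r, 'z) negotiation_scheme \<Rightarrow> ('n, 'r) history \<Rightarrow> ('a, 'n) marking" where
  "marking_after \<N> h = fold (occur_round \<N>) h (init_marking \<N>)"

inductive play_history ::
  "('a, 'n, 'r, 'z) negotiation_scheme \<Rightarrow> ('n, 'r) history \<Rightarrow> bool"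
  for \<N> where
  Nil: "play_history \<N> []"
| snoc: "\<lbrakk>play_history \<N> h; legal_round \<N> (marking_after \<N> h) m\<rbrakk> \<Longrightarrow> play_history \<N> (h @ [m])"

datatype ('n, 'r) play =
    Finite_Play "('n, 'r) round list"
  | Infinite_Play "nat \<Rightarrow> ('n, 'r) round"

fun is_play :: "('a, 'n, 'r, 'z) negotiation_scheme \<Rightarrow> ('n, 'r) play \<Rightarrow> bool" where
  "is_play \<N> (Finite_Play h) \<longleftrightarrow>
    play_history \<N> h \<and> (\<forall>n. \<not> enables \<N> (marking_after \<N> h) n)"
| "is_play \<N> (Infinite_Play f) \<longleftrightarrow> (\<forall>k. play_history \<N> (map f [0..<k]))"

fun play_prefixes :: "('n, 'r) play \<Rightarrow> ('n, 'r) history set" where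
  "play_prefixes (Finite_Play h) = {take k h | k. True}"
| "play_prefixes (Infinite_Play f) = {map f [0..<k] | k. True}"

text \<open>In the following definitions the set \<open>M\<close> is the set of atoms owned by the player under
  consideration. Strategies are unconstrained on arguments that do not arise in any play.\<close>

type_synonym ('n, 'r) strategy = "('n, 'r) history \<Rightarrow> 'n set \<Rightarrow> ('n \<rightharpoonup> 'r)"

definition is_strategy ::
  "('a, 'n, 'r, 'z) negotiation_scheme \<Rightarrow> 'n set \<Rightarrow> ('n, 'r) strategy \<Rightarrow> bool" where
  "is_strategy \<N> M \<sigma> \<longleftrightarrow>
    (\<forall>h S. play_history \<N> h \<and> legal_choice \<N> (marking_after \<N> h) S \<longrightarrow>
      dom (\<sigma> h S) = S \<inter> M \<and> (\<forall>n r. \<sigma> h S n = Some r \<longrightarrow> r \<in> outcomes \<N> n))"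

definition consistent :: "'n set \<Rightarrow> ('n, 'r) strategy \<Rightarrow> ('n, 'r) play \<Rightarrow> bool" where
  "consistent M \<sigma> p \<longleftrightarrow> (\<forall>h m. h @ [m] \<in> play_prefixes p \<longrightarrow> m |` M = \<sigma> h (dom m))"

definition winning_strategy ::
  "('a, 'n, 'r, 'z) negotiation_scheme \<Rightarrow> 'n set \<Rightarrow> ('n, 'r) play set \<Rightarrow> ('n, 'r) strategy \<Rightarrow> bool" where
  "winning_strategy \<N> M W \<sigma> \<longleftrightarrow>
    is_strategy \<N> M \<sigma> \<and> (\<forall>p. is_play \<N> p \<and> consistent M \<sigma> p \<longrightarrow> p \<in> W)"

definition player1_termination_plays :: "('a, 'n, 'r, 'z) negotiation_scheme \<Rightarrow> ('n, 'r) play set" where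
  "player1_termination_plays \<N> = {Finite_Play h | h. h \<noteq> [] \<and> final_atom \<N> \<in> dom (last h)}"

definition player1_wins_termination_game :: "('a, 'n, 'r, 'z) arena_scheme \<Rightarrow> bool" where
  "player1_wins_termination_game \<N> \<longleftrightarrow>
    (\<exists>\<sigma>. winning_strategy \<N> (atoms1 \<N>) (player1_termination_plays \<N>) \<sigma>)"

text \<open>Transitions of deterministic agents are singletons except at the final atom, where
  \<^const>\<open>the_elem\<close> is unspecified. This is harmless, as the final atom is in every layer.\<close>

primrec attractor_layer :: "('a, 'n, 'r, 'z) arena_scheme \<Rightarrow> nat \<Rightarrow> 'n set" where
  "attractor_layer \<N> 0 = {final_atom \<N>}"
| "attractor_layer \<N> (Suc k) = attractor_layer \<N> k
    \<union> {n \<in> atoms1 \<N>. \<exists>r\<in>outcomes \<N> n. \<forall>a\<in>det_parties \<N> n.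
        the_elem (trans_fun \<N> n a r) \<in> attractor_layer \<N> k}
    \<union> {n \<in> atoms2 \<N>. \<forall>r\<in>outcomes \<N> n. \<forall>a\<in>det_parties \<N> n.
        the_elem (trans_fun \<N> n a r) \<in> attractor_layer \<N> k}"

definition attractor :: "('a, 'n, 'r, 'z) arena_scheme \<Rightarrow> 'n set" where
  "attractor \<N> = (\<Union>k. attractor_layer \<N> k)"

end

(* Since a dead marking of a sound negotiation is the final one, Player 1 wins a play iff it is
   finite.  Weak determinism and soundness give every atom a deterministic party, and a
   deterministic agent is always ready for exactly one atom before the end.  If n_0 is in the
   attractor, Player 1 keeps all deterministic agents inside it, and every round decreases the sum
   of their attractor ranks, so the play is finite.  If n_0 is not in the attractor, Player 2 keeps
   some deterministic agent outside it forever, so the final marking is never reached and, by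
   soundness, the play can always be continued. *)
theory Submission
  imports Defs
begin

section \<open>Occurrence sequences and reachable markings\<close>

lemma occurrence_seq_snoc:
  assumes "occurrence_seq \<N> x w y" "enables \<N> y n" "r \<in> outcomes \<N> n"
  shows "occurrence_seq \<N> x (w @ [(n, r)]) (occur \<N> n r y)"
  using assms by induction (auto intro: occurrence_seq.intros)

lemma occurrence_seq_append:
  assumes "occurrence_seq \<N> x v y" "occurrence_seq \<N> y w z"
  shows "occurrence_seq \<N> x (v @ w) z"
  using assms by induction (auto intro: occurrence_seq.intros)

text \<open>A list of atoms and outcomes determines the markings it passes through, so from
  \<open>x\<close> the list \<open>v\<close> can lead nowhere but to \<open>y\<close>.\<close>

lemma occurrence_seq_appendD:
  assumes "occurrence_seq \<N> x v y" "occurrence_seq \<N> x (v @ w) z"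
  shows "occurrence_seq \<N> y w z"
  using assms
  by (induction arbitrary: w) (auto elim: occurrence_seq.cases)

lemma reachable_init: "reachable \<N> (init_marking \<N>)"
  unfolding reachable_def by (blast intro: occurrence_seq.Nil)

lemma reachable_induct [consumes 1, case_names init step]:
  assumes "reachable \<N> x"
    and init: "P (init_marking \<N>)"
    and step: "\<And>y n r. \<lbrakk>P y; enables \<N> y n; r \<in> outcomes \<N> n\<rbrakk> \<Longrightarrow> P (occur \<N> n r y)"
  shows "P x"
proof -
  have "P z \<Longrightarrow> P y" if "occurrence_seq \<N> z w y" for z w y
    using that by induction (auto intro: step)
  with assms show ?thesis unfolding reachable_def by blast
qed

text \<open>Soundness extends a sequence leading to \<open>x\<close> to one leading to the final
  marking. The added part starts at \<open>x\<close>, where nothing can occur, so it must be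
  empty.\<close>

lemma sound_enabled_or_final:
  assumes "sound \<N>" "reachable \<N> x" "\<And>n. \<not> enables \<N> x n"
  shows "x = final_marking"
proof (rule ccontr)
  assume "x \<noteq> final_marking"
  with assms(1,2) obtain w v where "occurrence_seq \<N> (init_marking \<N>) w x"
    "occurrence_seq \<N> (init_marking \<N>) (w @ v) final_marking"
    unfolding sound_def reachable_def by blast
  then have "occurrence_seq \<N> x v final_marking" by (rule occurrence_seq_appendD)
  then show False using \<open>x \<noteq> final_marking\<close> assms(3) by cases auto
qed

section \<open>Rounds as occurrence sequences\<close>

lemma occur_round_eq:
  assumes "independent \<N> (dom m)" "m n = Some r" "a \<in> parties \<N> n"
  shows "occur_round \<N> m x a = trans_fun \<N> n a r"
proof -
  have "(THE n. n \<in> dom m \<and> a \<in> parties \<N> n) = n"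
    using assms unfolding independent_def by (intro the_equality) blast+
  then show ?thesis using assms(2,3) unfolding occur_round_def by auto
qed

lemma occur_round_other:
  assumes "\<And>n. n \<in> dom m \<Longrightarrow> a \<notin> parties \<N> n"
  shows "occur_round \<N> m x a = x a"
  using assms unfolding occur_round_def by auto

text \<open>Serves to peel one atom off a round in an induction. Each agent is a party of at most
  one atom of the round, so firing \<open>n\<close> last undoes nothing that the others did.\<close>

lemma occur_round_upd:
  assumes "independent \<N> (dom (m(n \<mapsto> r)))" "m n = None"
  shows "occur_round \<N> (m(n \<mapsto> r)) x = occur \<N> n r (occur_round \<N> m x)"
proof
  fix a
  have indep: "independent \<N> (dom m)"
    using assms(1) unfolding independent_def by auto
  consider "a \<in> parties \<N> n" | n' r' where "a \<notin> parties \<N> n" "m n' = Some r'" "a \<in> parties \<N> n'"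
    | "a \<notin> parties \<N> n" "\<And>n'. n' \<in> dom m \<Longrightarrow> a \<notin> parties \<N> n'"
    by blast
  then show "occur_round \<N> (m(n \<mapsto> r)) x a = occur \<N> n r (occur_round \<N> m x) a"
  proof cases
    case 1
    then show ?thesis using occur_round_eq[OF assms(1), of n r a x] by (simp add: occur_def)
  next
    case 2
    then have "(m(n \<mapsto> r)) n' = Some r'" using assms(2) by auto
    then show ?thesis
      using 2 occur_round_eq[OF assms(1) _ 2(3)] occur_round_eq[OF indep 2(2,3)]
      by (simp add: occur_def)
  next
    case 3
    then have "\<And>n'. n' \<in> dom (m(n \<mapsto> r)) \<Longrightarrow> a \<notin> parties \<N> n'" by auto
    from occur_round_other[of "m(n \<mapsto> r)", OF this] occur_round_other[of m, OF 3(2)] 3(1)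
    show ?thesis by (simp add: occur_def)
  qed
qed

text \<open>Soundness speaks of occurrence sequences, the game of simultaneous rounds. As the atoms
  of a round share no agent, firing some of them leaves the others enabled, and they can occur one
  after the other.\<close>

lemma occurrence_seq_occur_round:
  assumes "finite (dom m)" "independent \<N> (dom m)" "\<And>n. n \<in> dom m \<Longrightarrow> enables \<N> x n"
    and "\<And>n r. m n = Some r \<Longrightarrow> r \<in> outcomes \<N> n"
  shows "\<exists>w. occurrence_seq \<N> x w (occur_round \<N> m x)"
  using assms
proof (induction "dom m" arbitrary: m rule: finite_induct)
  case empty
  then have "occur_round \<N> m x = x" by (intro ext occur_round_other) auto
  then show ?case by (metis occurrence_seq.Nil)
next
  case (insert n D)
  define m' where "m' = m(n := None)"
  obtain r where r: "m n = Some r" using insert.hyps(4) by auto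
  have m: "m = m'(n \<mapsto> r)" and m'n: "m' n = None" using r unfolding m'_def by auto
  have D: "D = dom m'" using insert.hyps(2,4) unfolding m'_def by auto
  have m'm: "m n' = Some r'" if "m' n' = Some r'" for n' r'
    using that unfolding m'_def by (simp split: if_splits)
  have indep: "independent \<N> (dom m')"
    using insert.prems(1) m'm unfolding independent_def by blast
  have "\<exists>w. occurrence_seq \<N> x w (occur_round \<N> m' x)"
    using D indep insert.prems(2,3) m'm by (intro insert.hyps(3)) blast+
  then obtain w where w: "occurrence_seq \<N> x w (occur_round \<N> m' x)" ..
  have en: "enables \<N> x n" using insert.prems(2) r by blast
  have "occur_round \<N> m' x a = x a" if "a \<in> parties \<N> n" for a
  proof (rule occur_round_other)
    fix n' assume "n' \<in> dom m'"
    then have "n' \<in> dom m" "n' \<noteq> n" using m'm m'n by auto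
    with r insert.prems(1) that show "a \<notin> parties \<N> n'" unfolding independent_def by blast
  qed
  with en have "enables \<N> (occur_round \<N> m' x) n" unfolding enables_def by simp
  from occurrence_seq_snoc[OF w this insert.prems(3)[OF r]]
  have "occurrence_seq \<N> x (w @ [(n, r)]) (occur_round \<N> m x)"
    using occur_round_upd[of \<N> m' n r x] insert.prems(1) m'n m by simp
  then show ?case ..
qed

lemma marking_after_snoc: "marking_after \<N> (h @ [m]) = occur_round \<N> m (marking_after \<N> h)"
  by (simp add: marking_after_def)

lemma play_history_snocD:
  assumes "play_history \<N> (h @ [m])"
  shows "play_history \<N> h" "legal_round \<N> (marking_after \<N> h) m"
  using assms by (auto elim: play_history.cases)

lemma legal_roundD:
  assumes "legal_round \<N> x m"
  shows "dom m \<noteq> {}" "independent \<N> (dom m)" "n \<in> dom m \<Longrightarrow> enables \<N> x n"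
    and "m n = Some r \<Longrightarrow> r \<in> outcomes \<N> n"
  using assms unfolding legal_round_def legal_choice_def by blast+

section \<open>Finite plays, deterministic parties and the occurrence of the final atom\<close>

context negotiation
begin

lemma agents_nonempty: "agents \<N> \<noteq> {}"
  using parties_nonempty[OF final_in_atoms] parties_final by simp

lemma final_marking_not_enables: "\<not> enables \<N> final_marking n"
  using parties_nonempty unfolding enables_def final_marking_def by auto

lemma det_parties_subset: "det_parties \<N> n \<subseteq> {a. deterministic_agent \<N> a}"
  unfolding det_parties_def by blast

lemma finite_deterministic_agents: "finite {a. deterministic_agent \<N> a}"
  by (rule finite_subset[OF _ finite_agents]) (auto simp: deterministic_agent_def)

lemma finite_det_parties: "finite (det_parties \<N> n)"
  using finite_subset[OF det_parties_subset finite_deterministic_agents] .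

lemma trans_fun_det:
  assumes "n \<in> atoms \<N>" "n \<noteq> final_atom \<N>" "a \<in> det_parties \<N> n" "r \<in> outcomes \<N> n"
  shows "trans_fun \<N> n a r = {the_elem (trans_fun \<N> n a r)}"
  using assms unfolding det_parties_def deterministic_agent_def
  by (auto simp: is_singleton_the_elem)

lemma reachable_occur_round:
  assumes "reachable \<N> x" "legal_round \<N> x m"
  shows "reachable \<N> (occur_round \<N> m x)"
proof -
  have "dom m \<subseteq> atoms \<N>" using legal_roundD(3)[OF assms(2)] unfolding enables_def by blast
  then have "finite (dom m)" using finite_atoms finite_subset by blast
  then obtain w where "occurrence_seq \<N> x w (occur_round \<N> m x)"
    using occurrence_seq_occur_round[of m \<N> x] legal_roundD[OF assms(2)] by blast
  with assms(1) show ?thesis unfolding reachable_def by (blast intro: occurrence_seq_append)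
qed

lemma reachable_marking_after: "play_history \<N> h \<Longrightarrow> reachable \<N> (marking_after \<N> h)"
proof (induction rule: play_history.induct)
  case Nil
  then show ?case using reachable_init by (simp add: marking_after_def)
next
  case (snoc h m)
  then show ?case using reachable_occur_round by (simp add: marking_after_snoc)
qed

text \<open>By soundness the play ends in the final marking. Any atom of the last round has thus
  left its parties with empty sets, and only the final atom does so.\<close>

lemma finite_play_final:
  assumes "sound \<N>" "is_play \<N> (Finite_Play h)"
  shows "h \<noteq> []" "final_atom \<N> \<in> dom (last h)"
proof -
  have ph: "play_history \<N> h" using assms(2) by simp
  have fin: "marking_after \<N> h = final_marking"
    using sound_enabled_or_final[OF assms(1) reachable_marking_after[OF ph]] assms(2) by simp
  show "h \<noteq> []"
  proof
    assume "h = []"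
    then have "init_marking \<N> = final_marking" using fin by (simp add: marking_after_def)
    then show False using agents_nonempty
      unfolding init_marking_def final_marking_def by (meson ex_in_conv insert_not_empty)
  qed
  then obtain h' m where h: "h = h' @ [m]" by (metis append_butlast_last_id)
  note lr = play_history_snocD(2)[OF ph[unfolded h]]
  obtain n r where n: "m n = Some r" using legal_roundD(1)[OF lr] by blast
  have atom: "n \<in> atoms \<N>" using legal_roundD(3)[OF lr] n unfolding enables_def by blast
  obtain a where a: "a \<in> parties \<N> n" using parties_nonempty[OF atom] by blast
  have "trans_fun \<N> n a r = {}"
    using occur_round_eq[OF legal_roundD(2)[OF lr] n a, of "marking_after \<N> h'"] fin h
    by (simp add: marking_after_snoc final_marking_def)
  then have "n = final_atom \<N>" using trans_empty_iff[OF atom a] legal_roundD(4)[OF lr n] by blast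
  with n h show "final_atom \<N> \<in> dom (last h)" by auto
qed

text \<open>The case that the initial atom is also final is covered: even for an empty transition,
  weak determinism provides an agent.\<close>

lemma ex_deterministic_agent:
  assumes "weakly_deterministic \<N>"
  shows "\<exists>b. deterministic_agent \<N> b"
proof -
  obtain a where "a \<in> parties \<N> (init_atom \<N>)" using parties_nonempty[OF init_in_atoms] by blast
  moreover obtain r where "r \<in> outcomes \<N> (init_atom \<N>)"
    using outcomes_nonempty[OF init_in_atoms] by blast
  ultimately show ?thesis using assms init_in_atoms unfolding weakly_deterministic_def by blast
qed

text \<open>An entry of a reachable marking is either still the initial one or a value of the
  transition function. In the first case every agent is a party of the initial atom; in the second,
  weak determinism applies.\<close>

lemma reachable_common_det_party:
  assumes "weakly_deterministic \<N>" "reachable \<N> x"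
  shows "\<exists>b. deterministic_agent \<N> b \<and> (\<forall>n\<in>x a. b \<in> parties \<N> n)"
  using assms(2)
proof (induction rule: reachable_induct)
  case init
  obtain b where "deterministic_agent \<N> b" using ex_deterministic_agent[OF assms(1)] ..
  then show ?case
    by (auto simp: init_marking_def parties_init deterministic_agent_def)
next
  case (step y n r)
  then show ?case
    using assms(1) unfolding occur_def weakly_deterministic_def enables_def by auto
qed

text \<open>Soundness provides a reachable marking that enables \<open>n\<close>. There
  \<open>n\<close> lies in the entry of any of its parties, and a deterministic agent common to all
  atoms of that entry is in particular a party of \<open>n\<close>.\<close>

lemma det_parties_nonempty:
  assumes "sound \<N>" "weakly_deterministic \<N>" "n \<in> atoms \<N>"
  shows "det_parties \<N> n \<noteq> {}"
proof -
  obtain x where x: "reachable \<N> x" "enables \<N> x n" using assms(1,3) unfolding sound_def by blast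
  obtain a where "a \<in> parties \<N> n" using parties_nonempty[OF assms(3)] by blast
  then have "n \<in> x a" using x(2) unfolding enables_def by blast
  then show ?thesis
    using reachable_common_det_party[OF assms(2) x(1), of a] unfolding det_parties_def by blast
qed

lemma occur_round_final:
  assumes "legal_round \<N> x m" "reachable \<N> x" "final_atom \<N> \<in> dom m"
  shows "occur_round \<N> m x = final_marking"
proof
  fix a
  obtain r where r: "m (final_atom \<N>) = Some r" using assms(3) by blast
  \<comment> \<open>Markings are total functions, so equality with \<open>final_marking\<close> also
    concerns agents outside \<open>agents \<N>\<close>, whose entries are empty from the
    start.\<close>
  have outside: "y a = {}" if "reachable \<N> y" "a \<notin> agents \<N>" for y
    using that(1)
  proof (induction rule: reachable_induct)
    case init
    then show ?case using that(2) by (simp add: init_marking_def)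
  next
    case (step y n r)
    then show ?case using that(2) parties_subset[of n] unfolding occur_def enables_def by auto
  qed
  show "occur_round \<N> m x a = final_marking a"
  proof (cases "a \<in> agents \<N>")
    case True
    then have a: "a \<in> parties \<N> (final_atom \<N>)" by (simp add: parties_final)
    show ?thesis
      using occur_round_eq[OF legal_roundD(2)[OF assms(1)] r a] legal_roundD(4)[OF assms(1) r]
        trans_empty_iff[OF final_in_atoms a] by (simp add: final_marking_def)
  next
    case False
    then show ?thesis
      using outside reachable_occur_round[OF assms(2,1)] by (simp add: final_marking_def)
  qed
qed

end

section \<open>Ranks and closure properties of the attractor\<close>

context negotiation_arena
begin

text \<open>Meaningful only for atoms of the attractor; elsewhere the value is unspecified.\<close>

definition attractor_rank :: "'n \<Rightarrow> nat" where
  "attractor_rank n = (LEAST k. n \<in> attractor_layer \<N> k)"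

lemma attractor_layer_mono: "k \<le> l \<Longrightarrow> attractor_layer \<N> k \<subseteq> attractor_layer \<N> l"
  by (rule lift_Suc_mono_le[of "attractor_layer \<N>"]) auto

lemma final_in_attractor: "final_atom \<N> \<in> attractor \<N>"
  unfolding attractor_def by (auto intro: exI[of _ 0])

lemma attractor_rank_le: "n \<in> attractor_layer \<N> k \<Longrightarrow> attractor_rank n \<le> k"
  unfolding attractor_rank_def by (rule Least_le)

text \<open>An atom other than the final one has a rank \<open>Suc k\<close>. It is in layer
  \<open>Suc k\<close> but not in layer \<open>k\<close>, so it entered by the clause of its owner,
  and the successors named there lie in layer \<open>k\<close>.\<close>

lemma attractor_cases:
  assumes "n \<in> attractor \<N>" "n \<noteq> final_atom \<N>"
  shows "n \<in> atoms1 \<N> \<and> (\<exists>r\<in>outcomes \<N> n. \<forall>a\<in>det_parties \<N> n.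
        the_elem (trans_fun \<N> n a r) \<in> attractor \<N> \<and>
        attractor_rank (the_elem (trans_fun \<N> n a r)) < attractor_rank n) \<or>
      n \<in> atoms2 \<N> \<and> (\<forall>r\<in>outcomes \<N> n. \<forall>a\<in>det_parties \<N> n.
        the_elem (trans_fun \<N> n a r) \<in> attractor \<N> \<and>
        attractor_rank (the_elem (trans_fun \<N> n a r)) < attractor_rank n)"
proof -
  have n: "n \<in> attractor_layer \<N> (attractor_rank n)"
    using assms(1) unfolding attractor_def attractor_rank_def by (auto intro: LeastI)
  then obtain k where k: "attractor_rank n = Suc k" using assms(2) by (cases "attractor_rank n") auto
  have "n \<notin> attractor_layer \<N> k" using attractor_rank_le[of n k] k by auto
  moreover have "s \<in> attractor \<N> \<and> attractor_rank s < attractor_rank n"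
    if "s \<in> attractor_layer \<N> k" for s
    using that attractor_rank_le[OF that] k unfolding attractor_def by auto
  ultimately show ?thesis using n unfolding k by simp blast
qed

text \<open>Layers increase, so finitely many atoms fit into the largest layer needed. This makes
  the union of the layers closed under one more attractor step.\<close>

lemma finite_subset_attractor_layer:
  assumes "finite T" "T \<subseteq> attractor \<N>"
  shows "\<exists>k. T \<subseteq> attractor_layer \<N> k"
proof -
  from assms(2) have "\<forall>t\<in>T. \<exists>k. t \<in> attractor_layer \<N> k" unfolding attractor_def by blast
  then obtain f where f: "\<And>t. t \<in> T \<Longrightarrow> t \<in> attractor_layer \<N> (f t)" by metis
  have "T \<subseteq> attractor_layer \<N> (Max (f ` T))"
    using f attractor_layer_mono[OF Max_ge[OF finite_imageI[OF assms(1)]]] by blast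
  then show ?thesis ..
qed

text \<open>Used in contraposition: at an atom of Player 1 outside the attractor, every outcome
  sends some deterministic party outside.\<close>

lemma attractor_closed1:
  assumes "n \<in> atoms1 \<N>" "r \<in> outcomes \<N> n"
    and "\<And>a. a \<in> det_parties \<N> n \<Longrightarrow> the_elem (trans_fun \<N> n a r) \<in> attractor \<N>"
  shows "n \<in> attractor \<N>"
proof -
  have "\<exists>k. (\<lambda>a. the_elem (trans_fun \<N> n a r)) ` det_parties \<N> n \<subseteq> attractor_layer \<N> k"
    using assms(3) finite_det_parties by (intro finite_subset_attractor_layer) auto
  then obtain k where "\<forall>a\<in>det_parties \<N> n. the_elem (trans_fun \<N> n a r) \<in> attractor_layer \<N> k"
    by blast
  then have "n \<in> attractor_layer \<N> (Suc k)" using assms(1,2) by auto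
  then show ?thesis unfolding attractor_def by blast
qed

text \<open>Here one layer must hold the successors under all outcomes, so finiteness of the set of
  outcomes enters.\<close>

lemma attractor_closed2:
  assumes "n \<in> atoms2 \<N>"
    and "\<And>a r. \<lbrakk>r \<in> outcomes \<N> n; a \<in> det_parties \<N> n\<rbrakk>
      \<Longrightarrow> the_elem (trans_fun \<N> n a r) \<in> attractor \<N>"
  shows "n \<in> attractor \<N>"
proof -
  have "finite (outcomes \<N> n)" using assms(1) atoms_union finite_outcomes by blast
  then have "\<exists>k. (\<lambda>(r, a). the_elem (trans_fun \<N> n a r)) ` (outcomes \<N> n \<times> det_parties \<N> n)
      \<subseteq> attractor_layer \<N> k"
    using assms(2) finite_det_parties by (intro finite_subset_attractor_layer) auto
  then obtain k where "\<forall>r\<in>outcomes \<N> n. \<forall>a\<in>det_parties \<N> n.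
      the_elem (trans_fun \<N> n a r) \<in> attractor_layer \<N> k"
    by (fastforce simp: image_subset_iff)
  then have "n \<in> attractor_layer \<N> (Suc k)" using assms(1) by auto
  then show ?thesis unfolding attractor_def by blast
qed

section \<open>Player 1 wins if the initial atom is in the attractor\<close>

definition attractor_marking :: "('a, 'n) marking \<Rightarrow> bool" where
  "attractor_marking x \<longleftrightarrow> (\<forall>a. deterministic_agent \<N> a \<longrightarrow> (\<exists>n\<in>attractor \<N>. x a = {n}))"

text \<open>The measure for termination. Each \<open>the_elem\<close> is meaningful under
  \<open>attractor_marking\<close>, where deterministic agents have singleton entries.\<close>

definition marking_rank :: "('a, 'n) marking \<Rightarrow> nat" where
  "marking_rank x = (\<Sum>a | deterministic_agent \<N> a. attractor_rank (the_elem (x a)))"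

text \<open>The guards inside the choice keep it satisfiable outside the attractor and at the final
  atom, where a strategy must still return some outcome.\<close>

definition attractor_outcome :: "'n \<Rightarrow> 'r" where
  "attractor_outcome n = (SOME r. r \<in> outcomes \<N> n \<and>
    (n \<in> attractor \<N> \<longrightarrow> n \<noteq> final_atom \<N> \<longrightarrow> (\<forall>a\<in>det_parties \<N> n.
      the_elem (trans_fun \<N> n a r) \<in> attractor \<N> \<and>
      attractor_rank (the_elem (trans_fun \<N> n a r)) < attractor_rank n)))"

lemma attractor_outcome:
  assumes "n \<in> atoms1 \<N>"
  shows "attractor_outcome n \<in> outcomes \<N> n"
    and "\<lbrakk>n \<in> attractor \<N>; n \<noteq> final_atom \<N>; a \<in> det_parties \<N> n\<rbrakk> \<Longrightarrow>
      the_elem (trans_fun \<N> n a (attractor_outcome n)) \<in> attractor \<N> \<and>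
      attractor_rank (the_elem (trans_fun \<N> n a (attractor_outcome n))) < attractor_rank n"
proof -
  have "n \<in> atoms \<N>" "n \<notin> atoms2 \<N>" using assms atoms_union atoms_disjoint by blast+
  then have "\<exists>r. r \<in> outcomes \<N> n \<and>
    (n \<in> attractor \<N> \<longrightarrow> n \<noteq> final_atom \<N> \<longrightarrow> (\<forall>a\<in>det_parties \<N> n.
      the_elem (trans_fun \<N> n a r) \<in> attractor \<N> \<and>
      attractor_rank (the_elem (trans_fun \<N> n a r)) < attractor_rank n))"
    using attractor_cases[of n] outcomes_nonempty[of n] by blast
  from someI_ex[OF this, folded attractor_outcome_def]
  show "attractor_outcome n \<in> outcomes \<N> n"
    and "\<lbrakk>n \<in> attractor \<N>; n \<noteq> final_atom \<N>; a \<in> det_parties \<N> n\<rbrakk> \<Longrightarrow>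
      the_elem (trans_fun \<N> n a (attractor_outcome n)) \<in> attractor \<N> \<and>
      attractor_rank (the_elem (trans_fun \<N> n a (attractor_outcome n))) < attractor_rank n"
    by blast+
qed

text \<open>A deterministic agent taking part in the round moves to an atom of smaller rank, by the
  chosen outcome at atoms of Player 1 and by any outcome at atoms of Player 2; all others stay. The
  final atom is excluded because it would empty the entries and destroy the singletons.\<close>

lemma attractor_marking_step:
  assumes "sound \<N>" "weakly_deterministic \<N>"
    and "attractor_marking x" "legal_round \<N> x m" "final_atom \<N> \<notin> dom m"
    and m1: "\<And>n. n \<in> dom m \<inter> atoms1 \<N> \<Longrightarrow> m n = Some (attractor_outcome n)"
  shows "attractor_marking (occur_round \<N> m x)"
    and "marking_rank (occur_round \<N> m x) < marking_rank x"
proof -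
  let ?y = "occur_round \<N> m x"
  note lr = legal_roundD[OF assms(4)]
  have moved: "\<exists>s\<in>attractor \<N>. ?y a = {s} \<and> x a = {n} \<and> attractor_rank s < attractor_rank n"
    if n: "m n = Some r" and a: "a \<in> det_parties \<N> n" for n r a
  proof -
    have r: "r \<in> outcomes \<N> n" using lr(4)[OF n] .
    have en: "enables \<N> x n" using n by (intro lr(3)) blast
    have atom: "n \<in> atoms \<N>" using en unfolding enables_def by blast
    have nf: "n \<noteq> final_atom \<N>" using assms(5) n by blast
    have "n \<in> x a" "deterministic_agent \<N> a"
      using a en unfolding enables_def det_parties_def by auto
    \<comment> \<open>The invariant makes the entry of \<open>a\<close> a singleton in the
      attractor, and as \<open>n\<close> is enabled, this singleton must be
      \<open>n\<close>.\<close>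
    then have xa: "x a = {n}" and nA: "n \<in> attractor \<N>"
      using assms(3) unfolding attractor_marking_def by auto
    define s where "s = the_elem (trans_fun \<N> n a r)"
    have "s \<in> attractor \<N> \<and> attractor_rank s < attractor_rank n"
    proof (cases "n \<in> atoms1 \<N>")
      case True
      then have "r = attractor_outcome n" using m1[of n] n by auto
      then show ?thesis using attractor_outcome(2)[OF True nA nf a] s_def by simp
    next
      case False
      then show ?thesis using attractor_cases[OF nA nf] r a s_def by blast
    qed
    moreover have "?y a = {s}"
      using occur_round_eq[OF lr(2) n, of a x] trans_fun_det[OF atom nf a r] a
      unfolding s_def det_parties_def by simp
    ultimately show ?thesis using xa by blast
  qed
  have fixed_or_moved: "?y a = x a \<or> (\<exists>s\<in>attractor \<N>. \<exists>n.
      ?y a = {s} \<and> x a = {n} \<and> attractor_rank s < attractor_rank n)"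
    if "deterministic_agent \<N> a" for a
  proof (cases "\<exists>n\<in>dom m. a \<in> parties \<N> n")
    case True
    then obtain n r where n: "m n = Some r" and "a \<in> parties \<N> n" by blast
    with that have "a \<in> det_parties \<N> n" unfolding det_parties_def by blast
    from moved[OF n this] show ?thesis by blast
  next
    case False
    then show ?thesis using occur_round_other[of m a] by blast
  qed
  show "attractor_marking ?y"
    unfolding attractor_marking_def
  proof (intro allI impI)
    fix a assume "deterministic_agent \<N> a"
    then show "\<exists>n\<in>attractor \<N>. ?y a = {n}"
      using fixed_or_moved[of a] assms(3) unfolding attractor_marking_def by auto
  qed
  \<comment> \<open>Scheduler's set is nonempty and each of its atoms has a deterministic party, so
    at least one summand drops strictly.\<close>
  obtain n r where n: "m n = Some r" using lr(1) by blast
  have "enables \<N> x n" using n by (intro lr(3)) blast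
  then obtain a where a: "a \<in> det_parties \<N> n"
    using det_parties_nonempty[OF assms(1,2), of n] unfolding enables_def by blast
  show "marking_rank ?y < marking_rank x"
    unfolding marking_rank_def
  proof (rule sum_strict_mono_ex1)
    show "finite {a. deterministic_agent \<N> a}" by (rule finite_deterministic_agents)
    show "\<forall>a\<in>{a. deterministic_agent \<N> a}.
        attractor_rank (the_elem (?y a)) \<le> attractor_rank (the_elem (x a))"
      using fixed_or_moved by fastforce
    show "\<exists>a\<in>{a. deterministic_agent \<N> a}.
        attractor_rank (the_elem (?y a)) < attractor_rank (the_elem (x a))"
      using moved[OF n a] a unfolding det_parties_def by auto
  qed
qed

definition attractor_strategy :: "('n, 'r) strategy" where
  "attractor_strategy h S = (\<lambda>n. if n \<in> S \<inter> atoms1 \<N> then Some (attractor_outcome n) else None)"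

lemma is_strategy_attractor_strategy: "is_strategy \<N> (atoms1 \<N>) attractor_strategy"
  unfolding is_strategy_def attractor_strategy_def
  by (auto simp: dom_def attractor_outcome split: if_splits)

lemma attractor_strategy_no_infinite_play:
  assumes "sound \<N>" "weakly_deterministic \<N>" "init_atom \<N> \<in> attractor \<N>"
    and "is_play \<N> (Infinite_Play f)"
    and "consistent (atoms1 \<N>) attractor_strategy (Infinite_Play f)"
  shows False
proof -
  define x where "x k = marking_after \<N> (map f [0..<k])" for k
  have x0: "x 0 = init_marking \<N>" by (simp add: x_def marking_after_def)
  have xSuc: "x (Suc k) = occur_round \<N> (f k) (x k)" for k
    by (simp add: x_def marking_after_snoc)
  have ph: "play_history \<N> (map f [0..<k])" for k using assms(4) by simp
  have legal: "legal_round \<N> (x k) (f k)" for k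
    using play_history_snocD(2)[of \<N> "map f [0..<k]" "f k"] ph[of "Suc k"] by (simp add: x_def)
  have reach: "reachable \<N> (x k)" for k
    using reachable_marking_after[OF ph] by (simp add: x_def)
  \<comment> \<open>The final atom would lead to a marking that enables nothing, but an infinite
    play always has a next round.\<close>
  have not_final: "final_atom \<N> \<notin> dom (f k)" for k
  proof
    assume "final_atom \<N> \<in> dom (f k)"
    then have "x (Suc k) = final_marking"
      using occur_round_final[OF legal reach] xSuc by simp
    then show False
      using legal_roundD(1,3)[OF legal[of "Suc k"]] final_marking_not_enables by fastforce
  qed
  have choice: "f k n = Some (attractor_outcome n)" if "n \<in> dom (f k) \<inter> atoms1 \<N>" for k n
  proof -
    have "map f [0..<k] @ [f k] = map f [0..<Suc k]" by simp
    then have "map f [0..<k] @ [f k] \<in> play_prefixes (Infinite_Play f)"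
      unfolding play_prefixes.simps by blast
    then have "f k |` atoms1 \<N> = attractor_strategy (map f [0..<k]) (dom (f k))"
      using assms(5) unfolding consistent_def by blast
    then have "(f k |` atoms1 \<N>) n = Some (attractor_outcome n)"
      using that by (simp add: attractor_strategy_def)
    with that show ?thesis by simp
  qed
  \<comment> \<open>The rank falls by at least one per round, so \<open>k\<close> can never exceed
    the initial rank.\<close>
  have "attractor_marking (x k) \<and> marking_rank (x k) + k \<le> marking_rank (x 0)" for k
  proof (induction k)
    case 0
    show ?case using assms(3)
      by (auto simp: x0 attractor_marking_def init_marking_def deterministic_agent_def)
  next
    case (Suc k)
    then show ?case
      using attractor_marking_step[OF assms(1,2) _ legal not_final choice, of k] xSuc by fastforce
  qed
  from this[of "Suc (marking_rank (x 0))"] show False by simp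
qed

lemma attractor_imp_player1_wins:
  assumes "sound \<N>" "weakly_deterministic \<N>" "init_atom \<N> \<in> attractor \<N>"
  shows "player1_wins_termination_game \<N>"
proof -
  have "p \<in> player1_termination_plays \<N>"
    if "is_play \<N> p" "consistent (atoms1 \<N>) attractor_strategy p" for p
  proof (cases p)
    case (Finite_Play h)
    then show ?thesis
      using finite_play_final[OF assms(1)] that unfolding player1_termination_plays_def by blast
  next
    case (Infinite_Play f)
    then show ?thesis using attractor_strategy_no_infinite_play[OF assms] that by blast
  qed
  then show ?thesis
    unfolding player1_wins_termination_game_def winning_strategy_def
    using is_strategy_attractor_strategy by blast
qed

section \<open>Player 1 cannot win if the initial atom is outside the attractor\<close>

definition outside_marking :: "('a, 'n) marking \<Rightarrow> bool" where
  "outside_marking x \<longleftrightarrow> (\<exists>a n. deterministic_agent \<N> a \<and> x a = {n} \<and> n \<notin> attractor \<N>)"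

text \<open>The contrapositive of \<open>attractor_closed2\<close>. The implication sits below the
  quantifier because an atom inside the attractor may also have to be fired, and then any outcome
  will do.\<close>

lemma ex_escaping_outcome:
  assumes "n \<in> atoms2 \<N>"
  shows "\<exists>r\<in>outcomes \<N> n. n \<notin> attractor \<N> \<longrightarrow>
    (\<exists>a\<in>det_parties \<N> n. the_elem (trans_fun \<N> n a r) \<notin> attractor \<N>)"
  using attractor_closed2[OF assms] outcomes_nonempty[of n] assms atoms_union by blast

text \<open>Scheduler and Player 2 may cooperate, since a winning strategy must win all consistent
  plays. The outside agent has a nonempty entry, so the marking is not final and soundness yields an
  enabled atom, which Scheduler offers alone.\<close>

lemma outside_marking_step:
  assumes "sound \<N>" "is_strategy \<N> (atoms1 \<N>) \<sigma>"
    and "play_history \<N> h" "outside_marking (marking_after \<N> h)"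
  shows "\<exists>m. legal_round \<N> (marking_after \<N> h) m \<and> m |` atoms1 \<N> = \<sigma> h (dom m) \<and>
    outside_marking (marking_after \<N> (h @ [m]))"
proof -
  let ?x = "marking_after \<N> h"
  obtain a n' where a: "deterministic_agent \<N> a" "?x a = {n'}" "n' \<notin> attractor \<N>"
    using assms(4) unfolding outside_marking_def by blast
  then have "?x \<noteq> final_marking" by (auto simp: final_marking_def)
  then obtain n where n: "enables \<N> ?x n"
    using sound_enabled_or_final[OF assms(1) reachable_marking_after[OF assms(3)]] by blast
  have atom: "n \<in> atoms \<N>" using n unfolding enables_def by blast
  have lc: "legal_choice \<N> ?x {n}" using n unfolding legal_choice_def independent_def by simp
  have dom\<sigma>: "dom (\<sigma> h {n}) = {n} \<inter> atoms1 \<N>"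
    and out\<sigma>: "\<And>r. \<sigma> h {n} n = Some r \<Longrightarrow> r \<in> outcomes \<N> n"
    using assms(2,3) lc unfolding is_strategy_def by blast+
  \<comment> \<open>At an atom of Player 1 the outcome is dictated by \<sigma> and cannot lead
    inside entirely; at an atom of Player 2 it is chosen so as to escape.\<close>
  have "\<exists>r\<in>outcomes \<N> n. [n \<mapsto> r] |` atoms1 \<N> = \<sigma> h {n} \<and> (n \<notin> attractor \<N> \<longrightarrow>
    (\<exists>a\<in>det_parties \<N> n. the_elem (trans_fun \<N> n a r) \<notin> attractor \<N>))"
  proof (cases "n \<in> atoms1 \<N>")
    case True
    then obtain r where r: "\<sigma> h {n} = [n \<mapsto> r]"
      using dom\<sigma> by (auto simp: dom_eq_singleton_conv)
    then have "r \<in> outcomes \<N> n" using out\<sigma> by simp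
    moreover have "[n \<mapsto> r] |` atoms1 \<N> = \<sigma> h {n}"
      using True r by (simp add: restrict_map_def fun_eq_iff)
    ultimately show ?thesis using attractor_closed1[OF True] by blast
  next
    case False
    then have "n \<in> atoms2 \<N>" using atom atoms_union by blast
    moreover have "[n \<mapsto> r] |` atoms1 \<N> = \<sigma> h {n}" for r
      using False dom\<sigma> by (simp add: restrict_map_def fun_eq_iff domIff)
    ultimately show ?thesis using ex_escaping_outcome[of n] by simp
  qed
  then obtain r where r: "r \<in> outcomes \<N> n" "[n \<mapsto> r] |` atoms1 \<N> = \<sigma> h {n}"
    and escape: "n \<notin> attractor \<N> \<Longrightarrow>
      \<exists>a\<in>det_parties \<N> n. the_elem (trans_fun \<N> n a r) \<notin> attractor \<N>"
    by blast
  have legal: "legal_round \<N> ?x [n \<mapsto> r]"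
    using lc r(1) unfolding legal_round_def by simp
  have "outside_marking (occur_round \<N> [n \<mapsto> r] ?x)"
  \<comment> \<open>If \<open>a\<close> takes part, its only atom \<open>n'\<close> is the fired
    one, and some deterministic party \<open>b\<close> of it, possibly another agent, becomes the
    new witness. Otherwise \<open>a\<close> stays where it is.\<close>
  proof (cases "a \<in> parties \<N> n")
    case True
    then have "n = n'" using n a(2) unfolding enables_def by auto
    with a(3) have nA: "n \<notin> attractor \<N>" by simp
    obtain b where b: "b \<in> det_parties \<N> n" "the_elem (trans_fun \<N> n b r) \<notin> attractor \<N>"
      using escape[OF nA] by blast
    have "n \<noteq> final_atom \<N>" using nA final_in_attractor by blast
    from trans_fun_det[OF atom this b(1) r(1)] occur_round_eq[OF legal_roundD(2)[OF legal]] b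
    show ?thesis unfolding outside_marking_def det_parties_def
      by (intro exI[of _ b] exI[of _ "the_elem (trans_fun \<N> n b r)"]) auto
  next
    case False
    then have "occur_round \<N> [n \<mapsto> r] ?x a = ?x a" by (intro occur_round_other) auto
    with a show ?thesis unfolding outside_marking_def by auto
  qed
  with legal r(2) show ?thesis
    by (intro exI[of _ "[n \<mapsto> r]"]) (simp add: marking_after_snoc)
qed

lemma ex_infinite_play_outside_attractor:
  assumes "sound \<N>" "weakly_deterministic \<N>" "init_atom \<N> \<notin> attractor \<N>"
    and "is_strategy \<N> (atoms1 \<N>) \<sigma>"
  shows "\<exists>f. is_play \<N> (Infinite_Play f) \<and> consistent (atoms1 \<N>) \<sigma> (Infinite_Play f)"
proof -
  \<comment> \<open>Since \<sigma> may depend on the whole history, so does the choice of the next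
    round; the play is therefore built by recursion on histories, and its rounds are read off from
    them.\<close>
  obtain next_round where nr: "\<lbrakk>play_history \<N> h; outside_marking (marking_after \<N> h)\<rbrakk> \<Longrightarrow>
      legal_round \<N> (marking_after \<N> h) (next_round h) \<and>
      next_round h |` atoms1 \<N> = \<sigma> h (dom (next_round h)) \<and>
      outside_marking (marking_after \<N> (h @ [next_round h]))" for h
    using outside_marking_step[OF assms(1,4)] by metis
  define hist where "hist = rec_nat [] (\<lambda>_ h. h @ [next_round h])"
  define f where "f k = next_round (hist k)" for k
  have hist_0: "hist 0 = []" and hist_Suc: "hist (Suc k) = hist k @ [f k]" for k
    by (simp_all add: hist_def f_def)
  have hist: "map f [0..<k] = hist k" for k
    by (induction k) (simp_all add: hist_0 hist_Suc)
  have inv: "play_history \<N> (hist k) \<and> outside_marking (marking_after \<N> (hist k))" for k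
  proof (induction k)
    case 0
    obtain b where "deterministic_agent \<N> b" using ex_deterministic_agent[OF assms(2)] ..
    then have "outside_marking (init_marking \<N>)"
      using assms(3) unfolding outside_marking_def init_marking_def deterministic_agent_def by auto
    then show ?case by (simp add: hist_0 marking_after_def play_history.Nil)
  next
    case (Suc k)
    then show ?case using nr[of "hist k"] by (simp add: hist_Suc f_def play_history.snoc)
  qed
  have "consistent (atoms1 \<N>) \<sigma> (Infinite_Play f)"
    unfolding consistent_def
  proof (intro allI impI)
    fix h m assume "h @ [m] \<in> play_prefixes (Infinite_Play f)"
    then obtain k where "h @ [m] = hist k" by (auto simp: hist)
    \<comment> \<open>A nonempty prefix is \<open>hist (Suc l)\<close> for some \<open>l\<close>,
      with last round \<open>f l\<close>.\<close>
    then obtain l where "h = hist l" "m = f l"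
      by (cases k) (auto simp: hist_0 hist_Suc)
    then show "m |` atoms1 \<N> = \<sigma> h (dom m)" using nr[of h] inv[of l] by (simp add: f_def)
  qed
  moreover have "is_play \<N> (Infinite_Play f)" using inv by (simp add: hist)
  ultimately show ?thesis by blast
qed

lemma player1_wins_imp_attractor:
  assumes "sound \<N>" "weakly_deterministic \<N>" "player1_wins_termination_game \<N>"
  shows "init_atom \<N> \<in> attractor \<N>"
proof (rule ccontr)
  assume "init_atom \<N> \<notin> attractor \<N>"
  moreover obtain \<sigma> where
    "winning_strategy \<N> (atoms1 \<N>) (player1_termination_plays \<N>) \<sigma>"
    using assms(3) unfolding player1_wins_termination_game_def ..
  ultimately obtain f where "Infinite_Play f \<in> player1_termination_plays \<N>"
    using ex_infinite_play_outside_attractor[OF assms(1,2)] unfolding winning_strategy_def by blast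
  then show False unfolding player1_termination_plays_def by blast
qed

end

theorem theorem4:
  fixes \<N> :: "('a, 'n, 'r) arena"
  assumes "negotiation_arena \<N>"
    and "sound \<N>"
    and "weakly_deterministic \<N>"
  shows "player1_wins_termination_game \<N> \<longleftrightarrow> init_atom \<N> \<in> attractor \<N>"
  using negotiation_arena.attractor_imp_player1_wins[OF assms]
    negotiation_arena.player1_wins_imp_attractor[OF assms] by blast

end
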